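(* Let $d\ge 2$, let $P$ be a probability distribution on $(\mathbb{R}^d,\mathcal{B}^d)$, and let $\mathcal{S}$ be the set of Euclidean motions of $\mathbb{R}^d$, i.e. maps $S(x)=Ax+c$ with $A\in\mathbb{O}(d)$ and $c\in\mathbb{R}^d$. (a) If $\theta$ is a quarter median for $P$ then, for all $S\in\mathcal{S}$, $S(\theta)$ is a quarter median for $P^S$. (b) If $U,V\in\mathbb{O}(d)$ are such that $U\sim V$, then $\Psi(U,P)=\Psi(V,P)$. (c) If $(\theta,U)$ solves the quarter median problem for $P$, then there is a marginal median $\eta\in\mathcal{M}(P^U)$ such that $(\tilde\theta,U)$ with $\tilde\theta=U^{t}\eta$ is also a solution of the quarter median problem for $P$. (d) If $(\theta,U)$ solves the quarter median problem for $P$ and $S\in\mathcal{S}$, $S(x)=Ax+c$, then $(A\theta+c,\,UA^{t})$ solves the quarter median problem for $P^S$. Moreover, if $P^b$ has a unique median for all $b\in\mathbb{S}_{d-1}$, then $$\Psi\bigl(UA^{t},P^S\bigr)=S\bigl(\Psi(U,P)\bigr).$$ (e) Suppose that $P^b$ has a unique median for all $b\in\mathbb{S}_{d-1}$. Then the function $\Psi(\,\cdot\,,P):\mathbb{O}(d)\to\mathbb{R}^d$ is continuous.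
   Context: $\mathcal{B}^d$ is the Borel $\sigma$-field of $\mathbb{R}^d$. Vectors are columns, $x^{t}$ denotes the transpose, $\langle x,y\rangle=x^{t}y$, $\mathbb{S}_{d-1}$ is the Euclidean unit sphere in $\mathbb{R}^d$, and $\mathbb{O}(d)$ is the group of orthogonal $d\times d$ matrices. For a measurable map $S$, $P^S$ is the push-forward of $P$ under $S$; for $b\in\mathbb{S}_{d-1}$ and $U\in\mathbb{O}(d)$, $P^b$ and $P^U$ are the push-forwards of $P$ under $x\mapsto\langle b,x\rangle$ and $x\mapsto Ux$; $P^{\pi_i}$ is the push-forward under the $i$th coordinate projection $\pi_i$. For a probability measure $Q$ on $\mathbb{R}$, a median is any $m$ with $Q((-\infty,m])\ge 1/2$ and $Q([m,\infty))\ge 1/2$; $\mathrm{Med}_-(Q)=\inf\{x: Q((-\infty,x])\ge 1/2\}$ and $\mathrm{Med}_+(Q)=\sup\{x:Q([x,\infty))\ge 1/2\}$ are the smallest and largest median, and $\mathrm{Med}_m(Q)=(\mathrm{Med}_-(Q)+\mathrm{Med}_+(Q))/2$. For a probability measure $P$ on $\mathbb{R}^d$, a marginal median is any vector whose $i$th coordinate is a median of $P^{\pi_i}$, $i=1,\ldots,d$; $\mathrm{MMed}_m(P)$ is the vector with $i$th coordinate $\mathrm{Med}_m(P^{\pi_i})$, and $$\mathcal{M}(P)=\prod_{i=1}^d\bigl\{\mathrm{Med}_-(P^{\pi_i}),\mathrm{Med}_m(P^{\pi_i}),\mathrm{Med}_+(P^{\pi_i})\bigr\}\subset\mathbb{R}^d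 .$$ For $U\in\mathbb{O}(d)$ put $\Psi(U,P)=U^{t}\,\mathrm{MMed}_m(P^U)$. For $a\in\mathbb{R}^d$ and $b\in\mathbb{S}_{d-1}$ let $H_-(a;b)=\{x:\langle b,x-a\rangle\le 0\}$ and $H_+(a;b)=\{x:\langle b,x-a\rangle\ge 0\}$. For orthogonal $b,b'\in\mathbb{S}_{d-1}$ and signs $\sigma,\sigma'\in\{+,-\}$ let $V_{\sigma\sigma'}(a;b,b')=H_\sigma(a;b)\cap H_{\sigma'}(a;b')$. A pair $(\theta,U)\in\mathbb{R}^d\times\mathbb{O}(d)$, where $U$ has rows $b_1^{t},\ldots,b_d^{t}$, solves the quarter median problem for $P$ if $P(H_\pm(\theta;b_i))\ge 1/2$ for $1\le i\le d$ and both signs, and $P(V_{\sigma\sigma'}(\theta;b_i,b_j))\ge 1/4$ for $1\le i<j\le d$ and all four sign combinations. A vector $\theta$ is a quarter median for $P$ if $(\theta,U)$ solves the quarter median problem for $P$ for some $U\in\mathbb{O}(d)$. For $U,V\in\mathbb{O}(d)$ write $U\sim V$ if the rows of $U$ and of $V$ determine the same set of linear hyperplanes $\{x: b_i^{t}x=0\}$, $i=1,\dots,d$; equivalently, $V=AU$ for some $A\in G$, where $G$ is the finite group of signed permutation matrices (generated by the diagonal matrices with diagonal entries $\pm1$ and the permutation matrices). *)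

theory Defs
  imports "HOL-Probability.Probability"
begin

abbreviation pushforward :: "'a measure \<Rightarrow> ('a \<Rightarrow> 'b::topological_space) \<Rightarrow> 'b measure" where
  "pushforward P S \<equiv> distr P borel S"

definition is_median :: "real measure \<Rightarrow> real \<Rightarrow> bool" where
  "is_median Q m \<longleftrightarrow> measure Q {..m} \<ge> 1/2 \<and> measure Q {m..} \<ge> 1/2"

definition Med_minus :: "real measure \<Rightarrow> real" where
  "Med_minus Q = Inf {x. measure Q {..x} \<ge> 1/2}"

definition Med_plus :: "real measure \<Rightarrow> real" where
  "Med_plus Q = Sup {x. measure Q {x..} \<ge> 1/2}"

definition Med_mid :: "real measure \<Rightarrow> real" where
  "Med_mid Q = (Med_minus Q + Med_plus Q) / 2"

definition marginal :: "(real ^ 'n) measure \<Rightarrow> 'n \<Rightarrow> real measure" where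
  "marginal P i = pushforward P (\<lambda>x. x $ i)"

definition is_marginal_median :: "(real ^ 'n) measure \<Rightarrow> real ^ 'n \<Rightarrow> bool" where
  "is_marginal_median P v \<longleftrightarrow> (\<forall>i. is_median (marginal P i) (v $ i))"

definition MMed_mid :: "(real ^ 'n) measure \<Rightarrow> real ^ 'n" where
  "MMed_mid P = (\<chi> i. Med_mid (marginal P i))"

definition MMed_set :: "(real ^ 'n) measure \<Rightarrow> (real ^ 'n) set" where
  "MMed_set P =
    {v. \<forall>i. v $ i \<in> {Med_minus (marginal P i), Med_mid (marginal P i), Med_plus (marginal P i)}}"

definition Psi :: "real ^ 'n ^ 'n \<Rightarrow> (real ^ 'n) measure \<Rightarrow> real ^ 'n" where
  "Psi U P = transpose U *v MMed_mid (pushforward P (\<lambda>x. U *v x))"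

definition unique_directional_medians :: "(real ^ 'n) measure \<Rightarrow> bool" where
  "unique_directional_medians P \<longleftrightarrow>
    (\<forall>b \<in> sphere 0 1. \<exists>!m. is_median (pushforward P (\<lambda>x. b \<bullet> x)) m)"

datatype side = Minus | Plus

fun halfspace :: "side \<Rightarrow> real ^ 'n \<Rightarrow> real ^ 'n \<Rightarrow> (real ^ 'n) set" where
  "halfspace Minus a b = {x. b \<bullet> (x - a) \<le> 0}"
| "halfspace Plus a b = {x. b \<bullet> (x - a) \<ge> 0}"

definition quarterspace ::
    "side \<Rightarrow> side \<Rightarrow> real ^ 'n \<Rightarrow> real ^ 'n \<Rightarrow> real ^ 'n \<Rightarrow> (real ^ 'n) set" where
  "quarterspace s s' a b b' = halfspace s a b \<inter> halfspace s' a b'"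

text \<open>
  The index type carries no order, so pairs \<open>i < j\<close> are replaced by \<open>i \<noteq> j\<close>. Exchanging
  \<open>i\<close> and \<open>j\<close> only exchanges the two signs, and all four sign combinations are required.
\<close>

definition solves_quarter_median ::
    "(real ^ 'n) measure \<Rightarrow> real ^ 'n \<Rightarrow> real ^ 'n ^ 'n \<Rightarrow> bool" where
  "solves_quarter_median P \<theta> U \<longleftrightarrow>
    orthogonal_matrix U \<and>
    (\<forall>i s. measure P (halfspace s \<theta> (row i U)) \<ge> 1/2) \<and>
    (\<forall>i j s s'. i \<noteq> j \<longrightarrow> measure P (quarterspace s s' \<theta> (row i U) (row j U)) \<ge> 1/4)"

definition is_quarter_median :: "(real ^ 'n) measure \<Rightarrow> real ^ 'n \<Rightarrow> bool" where
  "is_quarter_median P \<theta> \<longleftrightarrow> (\<exists>U. solves_quarter_median P \<theta> U)"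

definition euclidean_motions :: "(real ^ 'n \<Rightarrow> real ^ 'n) set" where
  "euclidean_motions = {S. \<exists>A c. orthogonal_matrix A \<and> S = (\<lambda>x. A *v x + c)}"

definition row_hyperplanes :: "real ^ 'n ^ 'n \<Rightarrow> (real ^ 'n) set set" where
  "row_hyperplanes U = {{x. row i U \<bullet> x = 0} | i. True}"

definition same_hyperplanes :: "real ^ 'n ^ 'n \<Rightarrow> real ^ 'n ^ 'n \<Rightarrow> bool" where
  "same_hyperplanes U V \<longleftrightarrow> row_hyperplanes U = row_hyperplanes V"

end

theory Submission
  imports Defs
begin

text \<open>
  Everything reduces to the one-dimensional marginals \<open>P\<^sup>b\<close> of a distribution \<open>P\<close> on
  \<open>\<real>\<^sup>d\<close>. Write \<open>m(b)\<close> for the midpoint median of \<open>P\<^sup>b\<close>. If \<open>U\<close> has rows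
  \<open>b\<^sub>1, \<dots>, b\<^sub>d\<close>, then \<open>\<Psi>(U, P) = \<Sum>\<^sub>i m(b\<^sub>i) b\<^sub>i\<close> (lemma \<open>Psi_eq_sum_rows\<close>). The claims
  about \<open>\<Psi>\<close> can be read off this formula.

  \<^item> Reflecting a distribution on the line swaps and negates its extreme medians, so
    \<open>m(-b) = -m(b)\<close> and the summand \<open>m(b) b\<close> depends only on the hyperplane orthogonal to
    the unit vector \<open>b\<close>. Hence \<open>\<Psi>(U, P)\<close> is a sum over the set of hyperplanes of \<open>U\<close>
    (\<open>sum_rows_cong_hyperplanes\<close>).
  \<^item> A motion \<open>x \<mapsto> A x + c\<close> turns the marginal in direction \<open>b\<close> into the marginal in
    direction \<open>A b\<close>, translated by \<open>\<langle>A b, c\<rangle>\<close>. The summands therefore become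
    \<open>m(b\<^sub>i) A b\<^sub>i + \<langle>A b\<^sub>i, c\<rangle> A b\<^sub>i\<close>, and the second parts add up to \<open>c\<close> because the
    \<open>A b\<^sub>i\<close> form an orthonormal basis (\<open>Psi_motion\<close>).
  \<^item> If medians are unique, then \<open>m\<close> is continuous on the sphere. By tightness, a
    half-space of mass below \<open>1/2\<close> keeps mass below \<open>1/2\<close> when it is tilted a little and
    moved slightly outwards. This makes \<open>m\<close> lower semicontinuous, and oddness turns that
    into continuity (\<open>directional_median_continuous\<close>).

  The same motion maps half-spaces to half-spaces, so that motions carry solutions of the
  quarter median problem to solutions (\<open>solves_quarter_median_motion\<close>).

  For the replacement of a solution by a marginal median in \<open>\<M>(P\<^sup>U)\<close>, note that no mass
  lies strictly between the smallest and the largest median of a distribution on the line.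
  A median strictly in between can thus be moved to the midpoint without changing the two
  half-lines that it bounds by more than a null set, and a median at either end need not be
  moved at all (\<open>ex_canonical_equivalent_median\<close>). Doing this in each direction \<open>b\<^sub>i\<close>
  alters all half-spaces, and hence all their intersections, only by null sets
  (\<open>solves_quarter_median_canonical\<close>).
\<close>

section \<open>Medians on the line\<close>

text \<open>
  The infimum that defines the smallest median is attained, because distribution functions
  are right-continuous.
\<close>

lemma (in real_distribution) Med_minus_le_iff:
  "measure M {..x} \<ge> 1/2 \<longleftrightarrow> Med_minus M \<le> x"
proof -
  let ?S = "{x. measure M {..x} \<ge> 1/2}"
  have up: "y \<in> ?S" if "x \<in> ?S" "x \<le> y" for x y
    using that cdf_nondecreasing[of x y] by (simp add: cdf_def)
  have "\<forall>\<^sub>F x in at_top. cdf M x > 1/2"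
    using order_tendstoD(1)[OF cdf_lim_at_top_prob, of "1/2"] by simp
  then obtain x0 where x0: "x0 \<in> ?S"
    by (auto simp: cdf_def eventually_at_top_linorder intro: less_imp_le)
  have "\<forall>\<^sub>F x in at_bot. cdf M x < 1/2"
    using order_tendstoD(2)[OF cdf_lim_at_bot, of "1/2"] by simp
  then obtain y0 where y0: "\<And>y. y \<le> y0 \<Longrightarrow> y \<notin> ?S"
    by (force simp: cdf_def eventually_at_bot_linorder)
  then have bdd: "bdd_below ?S"
    by (intro bdd_belowI[of _ y0]) (metis linear)
  have "1/2 \<le> cdf M (Med_minus M)"
  proof (rule tendsto_lowerbound)
    show "(cdf M \<longlongrightarrow> cdf M (Med_minus M)) (at_right (Med_minus M))"
      using cdf_is_right_cont by (simp add: continuous_within)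
    have "1/2 \<le> cdf M x" if x: "x > Med_minus M" for x
    proof -
      obtain z where "z \<in> ?S" "z < x"
        using cInf_lessD[of ?S x] x x0 unfolding Med_minus_def by auto
      with up[of z x] show ?thesis by (simp add: cdf_def)
    qed
    then show "\<forall>\<^sub>F x in at_right (Med_minus M). 1/2 \<le> cdf M x"
      by (simp add: eventually_at_filter)
  qed simp
  then have "Med_minus M \<in> ?S" by (simp add: cdf_def)
  with up have "x \<in> ?S" if "Med_minus M \<le> x" using that by blast
  moreover have "Med_minus M \<le> x" if "x \<in> ?S"
    unfolding Med_minus_def using that bdd by (rule cInf_lower)
  ultimately show ?thesis by auto
qed

text \<open>
  This transfers the results on the smallest median to the largest one.
\<close>

lemma (in real_distribution) Med_plus_eq_reflect:
  "Med_plus M = - Med_minus (distr M borel uminus)"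
proof -
  have "measure (distr M borel uminus) {..x} = measure M {-x..}" for x
    by (subst measure_distr) (auto intro!: arg_cong[where f="measure M"])
  then have "{x. measure (distr M borel uminus) {..x} \<ge> 1/2} = uminus ` {x. measure M {x..} \<ge> 1/2}"
    by (force simp: image_iff intro: exI[of _ "- _"])
  then show ?thesis
    by (simp add: Med_plus_def Med_minus_def Inf_real_def image_image)
qed

lemma (in real_distribution) Med_plus_ge_iff:
  "measure M {x..} \<ge> 1/2 \<longleftrightarrow> x \<le> Med_plus M"
proof -
  interpret R: real_distribution "distr M borel uminus"
    by (rule real_distribution_distr) measurable
  have "measure (distr M borel uminus) {..-x} = measure M {x..}"
    by (subst measure_distr) (auto intro!: arg_cong[where f="measure M"])
  then show ?thesis
    using R.Med_minus_le_iff[of "-x"] by (auto simp: Med_plus_eq_reflect)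
qed

text \<open>
  To the left of the smallest median the distribution function stays below \<open>1/2\<close>; so does
  its left limit there, and the closed half-line to the right has mass at least \<open>1/2\<close>.
\<close>

lemma (in real_distribution) Med_minus_le_Med_plus: "Med_minus M \<le> Med_plus M"
proof -
  have "measure M {..<Med_minus M} \<le> 1/2"
  proof (rule tendsto_upperbound[OF cdf_at_left])
    have "cdf M x \<le> 1/2" if "x < Med_minus M" for x
      using that Med_minus_le_iff[of x] by (simp add: cdf_def)
    then show "\<forall>\<^sub>F x in at_left (Med_minus M). cdf M x \<le> 1/2"
      by (simp add: eventually_at_filter)
  qed simp
  moreover have "measure M {Med_minus M..} = 1 - measure M {..<Med_minus M}"
    using prob_compl[of "{..<Med_minus M}"] by (simp add: Compl_eq_Diff_UNIV[symmetric])
  ultimately show ?thesis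
    by (simp add: Med_plus_ge_iff[symmetric])
qed

lemma (in real_distribution) is_median_iff:
  "is_median M m \<longleftrightarrow> m \<in> {Med_minus M..Med_plus M}"
  by (simp only: is_median_def Med_minus_le_iff Med_plus_ge_iff atLeastAtMost_iff)

lemma (in real_distribution) Med_mid_between:
  "Med_minus M \<le> Med_mid M" "Med_mid M \<le> Med_plus M"
  using Med_minus_le_Med_plus by (auto simp: Med_mid_def)

text \<open>
  Translations and reflections act on the set of medians in an obvious way. Since this set is
  a nonempty closed interval whose midpoint is \<^const>\<open>Med_mid\<close>, its image determines the
  midpoint median of the image distribution.
\<close>

lemma (in real_distribution) Med_mid_eq_if_medians_interval:
  assumes "\<And>m. is_median M m \<longleftrightarrow> m \<in> {a..b}"
  shows "Med_mid M = (a + b) / 2"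
proof -
  have "{Med_minus M..Med_plus M} = {a..b}"
    using assms is_median_iff by blast
  then show ?thesis
    using Med_minus_le_Med_plus by (simp add: Icc_eq_Icc Med_mid_def)
qed

lemma (in real_distribution) Med_mid_translate:
  "Med_mid (distr M borel (\<lambda>x. x + c)) = Med_mid M + c"
proof -
  interpret T: real_distribution "distr M borel (\<lambda>x. x + c)"
    by (rule real_distribution_distr) measurable
  have "measure (distr M borel (\<lambda>x. x + c)) {..m} = measure M {..m-c}"
       "measure (distr M borel (\<lambda>x. x + c)) {m..} = measure M {m-c..}" for m
    by (subst measure_distr; auto intro!: arg_cong[where f="measure M"])+
  then have "is_median (distr M borel (\<lambda>x. x + c)) m \<longleftrightarrow> m \<in> {Med_minus M + c..Med_plus M + c}" for m
    using is_median_iff[of "m - c"] by (auto simp: is_median_def algebra_simps)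
  from T.Med_mid_eq_if_medians_interval[OF this] show ?thesis
    by (simp add: Med_mid_def field_simps)
qed

lemma (in real_distribution) Med_mid_reflect:
  "Med_mid (distr M borel uminus) = - Med_mid M"
proof -
  interpret T: real_distribution "distr M borel uminus"
    by (rule real_distribution_distr) measurable
  have "measure (distr M borel uminus) {..m} = measure M {-m..}"
       "measure (distr M borel uminus) {m..} = measure M {..-m}" for m
    by (subst measure_distr; auto intro!: arg_cong[where f="measure M"])+
  then have "is_median (distr M borel uminus) m \<longleftrightarrow> m \<in> {- Med_plus M..- Med_minus M}" for m
    using is_median_iff[of "- m"] by (auto simp: is_median_def)
  from T.Med_mid_eq_if_medians_interval[OF this] show ?thesis
    by (simp add: Med_mid_def field_simps)
qed

text \<open>
  The two half-lines outside the open interval already carry mass \<open>1/2 + 1/2\<close>.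
\<close>

lemma (in real_distribution) AE_not_between_medians:
  "AE y in M. \<not> (Med_minus M < y \<and> y < Med_plus M)"
proof (cases "Med_minus M < Med_plus M")
  case True
  let ?a = "Med_minus M" and ?b = "Med_plus M"
  have "measure M {..?a} + measure M {?a<..<?b} + measure M {?b..} = 1"
  proof -
    have "measure M {..?a} + measure M {?a<..<?b} = measure M {..<?b}"
      using True by (subst finite_measure_Union[symmetric]) (auto intro!: arg_cong[where f="measure M"])
    moreover have "measure M {..<?b} + measure M {?b..} = measure M UNIV"
      by (subst finite_measure_Union[symmetric]) (auto intro!: arg_cong[where f="measure M"])
    ultimately show ?thesis using prob_space by simp
  qed
  moreover have "measure M {..?a} \<ge> 1/2" "measure M {?b..} \<ge> 1/2"
    by (simp_all only: Med_minus_le_iff Med_plus_ge_iff order_refl)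
  ultimately have "measure M {?a<..<?b} = 0"
    using measure_nonneg[of M "{?a<..<?b}"] by linarith
  then have "{?a<..<?b} \<in> null_sets M"
    by (simp add: null_sets_def emeasure_eq_measure)
  from AE_not_in[OF this] show ?thesis by simp
qed auto

text \<open>
  A median at an end of the interval of medians is kept, because the end point may be an
  atom. A median in the interior may be moved within the interior, which is a null set; the
  midpoint is a canonical choice.
\<close>

lemma (in real_distribution) ex_canonical_equivalent_median:
  assumes t: "is_median M t"
  obtains h where "h \<in> {Med_minus M, Med_mid M, Med_plus M}"
    "AE y in M. (y \<le> t \<longleftrightarrow> y \<le> h) \<and> (t \<le> y \<longleftrightarrow> h \<le> y)"
proof (cases "t = Med_minus M \<or> t = Med_plus M")
  case True
  then show ?thesis using that[of t] by auto
next
  case False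
  with t have "Med_minus M < t" "t < Med_plus M" by (auto simp: is_median_iff)
  moreover from this have "Med_minus M < Med_mid M" "Med_mid M < Med_plus M"
    by (auto simp: Med_mid_def)
  ultimately have "AE y in M. (y \<le> t \<longleftrightarrow> y \<le> Med_mid M) \<and> (t \<le> y \<longleftrightarrow> Med_mid M \<le> y)"
    by (intro eventually_mono[OF AE_not_between_medians]) auto
  then show ?thesis using that[of "Med_mid M"] by simp
qed

section \<open>Directional medians\<close>

definition directional_median :: "'a::euclidean_space measure \<Rightarrow> 'a \<Rightarrow> real" where
  "directional_median P b = Med_mid (pushforward P (\<lambda>x. b \<bullet> x))"

locale euclidean_distribution = prob_space P for P :: "'a::euclidean_space measure" +
  assumes sets_eq_borel[measurable_cong, simp]: "sets P = sets borel"
begin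

lemma space_eq_UNIV[simp]: "space P = UNIV"
  using sets_eq_imp_space_eq[OF sets_eq_borel] by simp

lemma continuous_imp_measurable:
  "continuous_on UNIV f \<Longrightarrow> f \<in> borel_measurable P"
  using borel_measurable_continuous_onI measurable_cong_sets[OF sets_eq_borel refl] by blast

lemma real_distribution_directional:
  "real_distribution (pushforward P (\<lambda>x. b \<bullet> x))"
  by (rule real_distribution_distr) (intro continuous_imp_measurable continuous_intros)

lemma measure_directional:
  "A \<in> sets borel \<Longrightarrow> measure (pushforward P (\<lambda>x. b \<bullet> x)) A = measure P {x. b \<bullet> x \<in> A}"
  by (subst measure_distr) (auto intro!: continuous_imp_measurable continuous_intros arg_cong[where f="measure P"])

lemma directional_median_minus: "directional_median P (- b) = - directional_median P b"
proof -
  interpret D: real_distribution "pushforward P (\<lambda>x. b \<bullet> x)"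
    by (rule real_distribution_directional)
  have "(\<lambda>x. b \<bullet> x) \<in> borel_measurable P"
    by (intro continuous_imp_measurable continuous_intros)
  then have "distr (pushforward P (\<lambda>x. b \<bullet> x)) borel uminus = pushforward P (\<lambda>x. (- b) \<bullet> x)"
    by (subst distr_distr) (simp_all add: comp_def inner_minus_left[abs_def])
  with D.Med_mid_reflect show ?thesis
    by (simp add: directional_median_def)
qed

lemma tight:
  assumes "\<delta> > 0"
  obtains R where "R > 0" "measure P {x. norm x > R} < \<delta>"
proof -
  have norm: "norm \<in> borel_measurable P"
    by (intro continuous_imp_measurable continuous_intros)
  interpret N: real_distribution "distr P borel norm"
    using norm by (rule real_distribution_distr)
  have "\<forall>\<^sub>F R in at_top. cdf (distr P borel norm) R > 1 - \<delta>"
    using order_tendstoD(1)[OF N.cdf_lim_at_top_prob] assms by simp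
  then have "\<forall>\<^sub>F R in at_top. cdf (distr P borel norm) R > 1 - \<delta> \<and> R > 0"
    using eventually_gt_at_top by (rule eventually_conj)
  then obtain R where R: "cdf (distr P borel norm) R > 1 - \<delta>" "R > 0"
    by (auto simp: eventually_at_top_linorder)
  have "cdf (distr P borel norm) R = measure P {x. norm x \<le> R}"
    unfolding cdf_def using norm
    by (subst measure_distr) (auto intro!: arg_cong[where f="measure P"])
  moreover have "{x. norm x > R} = space P - {x. norm x \<le> R}" by auto
  then have "measure P {x. norm x > R} = 1 - measure P {x. norm x \<le> R}"
    by (simp add: prob_compl[symmetric] closed_Collect_le borel_closed continuous_intros)
  ultimately show ?thesis using that R by simp
qed

text \<open>
  Let \<open>m\<close> be the median in direction \<open>b\<close>. Uniqueness makes the half-space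
  \<open>{x. b \<bullet> x \<le> m - \<epsilon>/2}\<close> have mass strictly below \<open>1/2\<close>. For \<open>b'\<close> near \<open>b\<close>, the half-space
  \<open>{x. b' \<bullet> x \<le> m - \<epsilon>}\<close> is contained in it up to the complement of a large ball of very
  small mass. Hence even the smallest median in direction \<open>b'\<close> exceeds \<open>m - \<epsilon>\<close>.
\<close>

lemma directional_median_lower_semicontinuous:
  assumes uniq: "\<exists>!m. is_median (pushforward P (\<lambda>x. b \<bullet> x)) m" and "\<epsilon> > 0"
  shows "\<forall>\<^sub>F b' in nhds b. directional_median P b' > directional_median P b - \<epsilon>"
proof -
  let ?Q = "\<lambda>b. pushforward P (\<lambda>x. b \<bullet> x)" and ?m = "directional_median P b"
  interpret D: real_distribution "?Q b" by (rule real_distribution_directional)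
  have "Med_minus (?Q b) = ?m"
    using uniq D.is_median_iff D.Med_minus_le_Med_plus D.Med_mid_between
    unfolding directional_median_def by (metis atLeastAtMost_iff order_refl)
  then have "measure (?Q b) {..?m - \<epsilon>/2} < 1/2"
    using D.Med_minus_le_iff[of "?m - \<epsilon>/2"] \<open>\<epsilon> > 0\<close> by simp
  then have less: "measure P {x. b \<bullet> x \<le> ?m - \<epsilon>/2} < 1/2"
    by (simp add: measure_directional)
  then obtain R where R: "R > 0"
      "measure P {x. norm x > R} < 1/2 - measure P {x. b \<bullet> x \<le> ?m - \<epsilon>/2}"
    using tight[of "1/2 - measure P {x. b \<bullet> x \<le> ?m - \<epsilon>/2}"] by auto
  \<comment> \<open>The radius \<open>\<epsilon>/(2 R)\<close> makes the tilt change the value of a point of norm at most \<open>R\<close> by at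
    most the other half of \<open>\<epsilon>\<close>.\<close>
  have "directional_median P b' > ?m - \<epsilon>" if b': "dist b' b < \<epsilon>/(2*R)" for b'
  proof -
    interpret D': real_distribution "?Q b'" by (rule real_distribution_directional)
    have "b \<bullet> x \<le> ?m - \<epsilon>/2" if x: "b' \<bullet> x \<le> ?m - \<epsilon>" "norm x \<le> R" for x
    proof -
      have "(b - b') \<bullet> x \<le> norm (b - b') * norm x"
        by (rule norm_cauchy_schwarz)
      also have "\<dots> \<le> \<epsilon>/(2*R) * R"
        using b' x by (intro mult_mono) (use R(1) \<open>\<epsilon> > 0\<close> in \<open>auto simp: dist_norm norm_minus_commute\<close>)
      finally show ?thesis
        using R(1) x by (simp add: inner_diff_left)
    qed
    then have "{x. b' \<bullet> x \<le> ?m - \<epsilon>} \<subseteq> {x. b \<bullet> x \<le> ?m - \<epsilon>/2} \<union> {x. norm x > R}"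
      by force
    then have "measure P {x. b' \<bullet> x \<le> ?m - \<epsilon>}
        \<le> measure P ({x. b \<bullet> x \<le> ?m - \<epsilon>/2} \<union> {x. norm x > R})"
      by (intro finite_measure_mono)
         (auto intro!: borel_closed borel_open sets.Un closed_Collect_le open_Collect_less continuous_intros)
    also have "\<dots> \<le> measure P {x. b \<bullet> x \<le> ?m - \<epsilon>/2} + measure P {x. norm x > R}"
      by (intro measure_Un_le)
         (auto intro!: borel_closed borel_open closed_Collect_le open_Collect_less continuous_intros)
    also have "\<dots> < 1/2" using R(2) by simp
    finally have "measure (?Q b') {..?m - \<epsilon>} < 1/2"
      by (simp add: measure_directional)
    then have "?m - \<epsilon> < Med_minus (?Q b')"
      using D'.Med_minus_le_iff[of "?m - \<epsilon>"] by simp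
    then show ?thesis
      using D'.Med_mid_between(1) by (simp add: directional_median_def)
  qed
  then show ?thesis
    unfolding eventually_nhds_metric using R(1) \<open>\<epsilon> > 0\<close>
    by (intro exI[of _ "\<epsilon>/(2*R)"]) auto
qed

text \<open>
  Since \<open>directional_median P (- b) = - directional_median P b\<close>, lower semicontinuity at
  \<open>- b\<close> is upper semicontinuity at \<open>b\<close>.
\<close>

lemma directional_median_continuous:
  assumes uniq: "\<And>b. b \<in> sphere 0 1 \<Longrightarrow> \<exists>!m. is_median (pushforward P (\<lambda>x. b \<bullet> x)) m"
  shows "continuous_on (sphere 0 1) (directional_median P)"
proof -
  have "isCont (directional_median P) b" if b: "b \<in> sphere 0 1" for b
  proof -
    have "\<forall>\<^sub>F b' in nhds b. dist (directional_median P b') (directional_median P b) < \<epsilon>"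
      if "\<epsilon> > 0" for \<epsilon>
    proof -
      have low: "\<forall>\<^sub>F b' in nhds b. directional_median P b' > directional_median P b - \<epsilon>"
        using b \<open>\<epsilon> > 0\<close> by (intro directional_median_lower_semicontinuous uniq)
      have "\<forall>\<^sub>F c in nhds (- b). directional_median P c > directional_median P (- b) - \<epsilon>"
        using b \<open>\<epsilon> > 0\<close> by (intro directional_median_lower_semicontinuous uniq) auto
      moreover have "filterlim uminus (nhds (- b)) (nhds b)"
        by (intro tendsto_intros filterlim_ident)
      ultimately have "\<forall>\<^sub>F b' in nhds b. directional_median P (- b') > directional_median P (- b) - \<epsilon>"
        unfolding filterlim_iff by blast
      with low show ?thesis
        by eventually_elim (auto simp: directional_median_minus dist_real_def)
    qed
    then have "(directional_median P \<longlongrightarrow> directional_median P b) (nhds b)"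
      by (simp add: tendsto_iff)
    then show ?thesis
      unfolding continuous_at using tendsto_mono at_within_le_nhds by blast
  qed
  then show ?thesis by (simp add: continuous_at_imp_continuous_on)
qed

end

section \<open>Orthonormal frames of rows\<close>

lemma orthogonal_matrix_inner:
  fixes A :: "real ^ 'n ^ 'n"
  assumes "orthogonal_matrix A"
  shows "(A *v x) \<bullet> (A *v y) = x \<bullet> y"
  using assms orthogonal_transformation_matrix[of "(*v) A"]
  by (simp add: orthogonal_transformation_def)

lemma orthogonal_matrix_row_inner:
  fixes U :: "real ^ 'n ^ 'n"
  assumes "orthogonal_matrix U"
  shows "row i U \<bullet> row j U = (if i = j then 1 else 0)"
proof -
  have "row i U \<bullet> row j U = (U ** transpose U) $ i $ j"
    by (simp add: inner_vec_def row_def transpose_def matrix_matrix_mult_def)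
  with assms show ?thesis by (simp add: orthogonal_matrix_def mat_def)
qed

lemma matrix_vector_mult_nth: "(U *v x) $ i = row i U \<bullet> (x :: real ^ 'n)"
  by (simp add: matrix_mult_dot row_def vec_nth_inverse)

lemma transpose_vector_mult_rows:
  fixes U :: "real ^ 'n ^ 'm"
  shows "transpose U *v y = (\<Sum>i\<in>UNIV. (y $ i) *\<^sub>R row i U)"
  by (simp add: matrix_mult_sum scalar_mult_eq_scaleR)

lemma row_inner_transpose_mult:
  fixes U :: "real ^ 'n ^ 'n"
  assumes "orthogonal_matrix U"
  shows "row i U \<bullet> (transpose U *v y) = y $ i"
proof -
  have "row i U \<bullet> (transpose U *v y) = (U *v (transpose U *v y)) $ i"
    by (simp add: matrix_vector_mult_nth)
  also have "\<dots> = y $ i"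
    using assms by (simp only: matrix_vector_mul_assoc orthogonal_matrix_def matrix_vector_mul_lid)
  finally show ?thesis .
qed

lemma row_mult_transpose:
  fixes U A :: "real ^ 'n ^ 'n"
  shows "row i (U ** transpose A) = A *v row i U"
proof -
  have "row i (U ** transpose A) = column i (transpose (U ** transpose A))" by simp
  also have "\<dots> = A *v row i U"
    by (simp add: matrix_transpose_mul vec_eq_iff column_def row_def transpose_def matrix_matrix_mult_def matrix_vector_mult_def mult.commute)
  finally show ?thesis .
qed

text \<open>
  The component of \<open>c\<close> orthogonal to \<open>b\<close> lies in the common hyperplane, so it is orthogonal
  to \<open>c\<close> as well as to \<open>b\<close>, and therefore vanishes.
\<close>

lemma unit_normal_unique_up_to_sign:
  fixes b c :: "'a::real_inner"
  assumes "norm b = 1" "norm c = 1" "{x. b \<bullet> x = 0} = {x. c \<bullet> x = 0}"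
  shows "c = b \<or> c = - b"
proof -
  have bc: "b \<bullet> b = 1" "c \<bullet> c = 1" using assms by (auto simp: norm_eq_1)
  let ?x = "c - (b \<bullet> c) *\<^sub>R b"
  have "b \<bullet> ?x = 0" using bc by (simp add: inner_diff_right)
  then have "c \<bullet> ?x = 0" using assms(3) by blast
  with \<open>b \<bullet> ?x = 0\<close> have "?x \<bullet> ?x = 0"
    by (simp add: inner_diff_left)
  then have c: "c = (b \<bullet> c) *\<^sub>R b" by simp
  with assms(1,2) have "\<bar>b \<bullet> c\<bar> = 1" by (metis mult.right_neutral norm_scaleR)
  with c show ?thesis
    by (metis abs_if scaleR_minus_left scaleR_one minus_minus)
qed

text \<open>
  An even function of a unit vector is a function of the hyperplane orthogonal to it.
  Distinct rows of an orthogonal matrix have distinct hyperplanes, so that the sum over the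
  rows is a sum over the set of hyperplanes, whatever their order.
\<close>

lemma sum_rows_cong_hyperplanes:
  fixes U V :: "real ^ 'n ^ 'n" and g :: "real ^ 'n \<Rightarrow> 'b::comm_monoid_add"
  assumes U: "orthogonal_matrix U" and V: "orthogonal_matrix V"
    and same: "same_hyperplanes U V" and even: "\<And>b. g (- b) = g b"
  shows "(\<Sum>i\<in>UNIV. g (row i U)) = (\<Sum>i\<in>UNIV. g (row i V))"
proof -
  \<comment> \<open>\<open>h H\<close> evaluates \<open>g\<close> at either of the two unit normals of \<open>H\<close>.\<close>
  define h where "h H = g (SOME b. norm b = 1 \<and> {x. b \<bullet> x = 0} = H)" for H
  have "(\<Sum>i\<in>UNIV. g (row i W)) = sum h (row_hyperplanes W)" if W: "orthogonal_matrix W" for W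
  proof -
    let ?H = "\<lambda>i. {x. row i W \<bullet> x = 0}"
    have unit: "norm (row i W) = 1" for i
      using orthogonal_matrix_row_inner[OF W, of i i] by (simp add: norm_eq_1)
    have "g (row i W) = h (?H i)" for i
    proof -
      let ?b = "SOME b. norm b = 1 \<and> {x. b \<bullet> x = 0} = ?H i"
      have "norm ?b = 1 \<and> {x. ?b \<bullet> x = 0} = ?H i"
        by (rule someI[of _ "row i W"]) (simp add: unit)
      then have "?b = row i W \<or> ?b = - row i W"
        using unit_normal_unique_up_to_sign[OF unit[of i], of ?b] by simp
      then have "g ?b = g (row i W)" using even by auto
      then show ?thesis unfolding h_def by simp
    qed
    moreover have "inj ?H"
    proof (rule injI)
      fix i j assume "?H i = ?H j"
      moreover have "row i W \<notin> ?H i"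
        using orthogonal_matrix_row_inner[OF W, of i i] by simp
      ultimately have "row j W \<bullet> row i W \<noteq> 0" by blast
      then show "i = j"
        using orthogonal_matrix_row_inner[OF W, of j i] by (auto split: if_splits)
    qed
    moreover have "row_hyperplanes W = range ?H" by (auto simp: row_hyperplanes_def)
    ultimately show ?thesis by (simp add: sum.reindex)
  qed
  with U V same show ?thesis by (simp add: same_hyperplanes_def)
qed

section \<open>The functional \<open>\<Psi>\<close> and the quarter median problem\<close>

lemma halfspace_iff:
  "x \<in> halfspace s a b \<longleftrightarrow> (case s of Minus \<Rightarrow> b \<bullet> x \<le> b \<bullet> a | Plus \<Rightarrow> b \<bullet> a \<le> b \<bullet> x)"
  by (cases s) (auto simp: inner_diff_right)

lemma halfspace_borel: "halfspace s a b \<in> sets borel"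
  by (cases s) (auto intro!: borel_closed closed_Collect_le continuous_intros)

lemma quarterspace_borel: "quarterspace s s' a b b' \<in> sets borel"
  unfolding quarterspace_def by (intro sets.Int halfspace_borel)

locale vector_distribution = euclidean_distribution P for P :: "(real ^ 'n) measure"
begin

lemma marginal_pushforward:
  "marginal (pushforward P (\<lambda>x. U *v x)) i = pushforward P (\<lambda>x. row i U \<bullet> x)"
proof -
  have "(\<lambda>x. U *v x) \<in> borel_measurable P"
    by (intro continuous_imp_measurable continuous_intros)
  then show ?thesis
    unfolding marginal_def
    by (subst distr_distr)
       (auto simp: comp_def matrix_vector_mult_nth intro!: borel_measurable_continuous_onI continuous_intros)
qed

text \<open>
  Multiplication by \<open>U\<^sup>t\<close> expands in the rows of \<open>U\<close>, so that the functional is a sum of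
  terms each of which depends on a single direction.
\<close>

lemma Psi_eq_sum_rows:
  "Psi U P = (\<Sum>i\<in>UNIV. directional_median P (row i U) *\<^sub>R row i U)"
  unfolding Psi_def transpose_vector_mult_rows MMed_mid_def marginal_pushforward
    directional_median_def by simp

lemma Psi_cong_hyperplanes:
  assumes "orthogonal_matrix U" "orthogonal_matrix V" "same_hyperplanes U V"
  shows "Psi U P = Psi V P"
  unfolding Psi_eq_sum_rows
  by (rule sum_rows_cong_hyperplanes[OF assms]) (simp add: directional_median_minus)

lemma vector_distribution_pushforward:
  assumes "continuous_on UNIV S"
  shows "vector_distribution (pushforward P S)"
proof -
  interpret S: prob_space "pushforward P S"
    using assms by (intro prob_space_distr continuous_imp_measurable)
  show ?thesis by unfold_locales simp
qed

text \<open>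
  The motion rotates the frame of directions, and translation equivariance of the midpoint
  median adds in each direction \<open>B i = A b\<^sub>i\<close> the coordinate of \<open>c\<close> in that direction.
\<close>

lemma Psi_motion:
  assumes U: "orthogonal_matrix U" and A: "orthogonal_matrix A"
  shows "Psi (U ** transpose A) (pushforward P (\<lambda>x. A *v x + c)) = A *v Psi U P + c"
proof -
  let ?S = "\<lambda>x. A *v x + c"
  have contS: "continuous_on UNIV ?S" by (intro continuous_intros)
  interpret S: vector_distribution "pushforward P ?S"
    using contS by (rule vector_distribution_pushforward)
  define B where "B i = A *v row i U" for i
  have dm: "directional_median (pushforward P ?S) (B i) = directional_median P (row i U) + B i \<bullet> c" for i
  proof -
    interpret D: real_distribution "pushforward P (\<lambda>x. row i U \<bullet> x)"
      by (rule real_distribution_directional)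
    have "(\<lambda>x. B i \<bullet> x) \<in> borel_measurable borel"
      by (intro borel_measurable_continuous_onI continuous_intros)
    then have "pushforward (pushforward P ?S) (\<lambda>x. B i \<bullet> x) = pushforward P (\<lambda>x. B i \<bullet> ?S x)"
      using continuous_imp_measurable[OF contS] by (subst distr_distr) (auto simp: comp_def)
    also have "\<dots> = pushforward P (\<lambda>x. row i U \<bullet> x + B i \<bullet> c)"
      by (simp add: B_def inner_add_right orthogonal_matrix_inner[OF A])
    also have "\<dots> = distr (pushforward P (\<lambda>x. row i U \<bullet> x)) borel (\<lambda>y. y + B i \<bullet> c)"
    proof -
      have "(\<lambda>x. row i U \<bullet> x) \<in> borel_measurable P"
        by (intro continuous_imp_measurable continuous_intros)
      then show ?thesis by (subst distr_distr) (auto simp: comp_def)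
    qed
    finally show ?thesis
      by (simp add: directional_median_def D.Med_mid_translate)
  qed
  have UA: "orthogonal_matrix (U ** transpose A)"
    using U A by (simp add: orthogonal_matrix_mul orthogonal_matrix_transpose)
  have "Psi (U ** transpose A) (pushforward P ?S)
      = (\<Sum>i\<in>UNIV. directional_median P (row i U) *\<^sub>R B i) + (\<Sum>i\<in>UNIV. (B i \<bullet> c) *\<^sub>R B i)"
    unfolding S.Psi_eq_sum_rows row_mult_transpose
    by (simp add: B_def[symmetric] dm scaleR_add_left sum.distrib)
  also have "(\<Sum>i\<in>UNIV. directional_median P (row i U) *\<^sub>R B i) = A *v Psi U P"
    unfolding Psi_eq_sum_rows B_def
    by (simp add: linear_sum[OF matrix_vector_mul_linear] linear_cmul[OF matrix_vector_mul_linear])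
  \<comment> \<open>Expansion of \<open>c\<close> in the orthonormal basis of the rows of \<open>U A\<^sup>t\<close>.\<close>
  also have "(\<Sum>i\<in>UNIV. (B i \<bullet> c) *\<^sub>R B i) = c"
  proof -
    have "(\<Sum>i\<in>UNIV. (B i \<bullet> c) *\<^sub>R B i) = transpose (U ** transpose A) *v ((U ** transpose A) *v c)"
      unfolding transpose_vector_mult_rows matrix_vector_mult_nth row_mult_transpose B_def ..
    also have "\<dots> = c"
      using UA by (simp only: matrix_vector_mul_assoc orthogonal_matrix_def matrix_vector_mul_lid)
    finally show ?thesis .
  qed
  finally show ?thesis .
qed

lemma Psi_continuous:
  assumes "unique_directional_medians P"
  shows "continuous_on {U. orthogonal_matrix U} (\<lambda>U. Psi U P)"
proof -
  have row: "continuous_on X (\<lambda>U. row i U)" for i X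
    unfolding row_def by (intro continuous_intros)
  have dm: "continuous_on (sphere 0 1) (directional_median P)"
    using assms unfolding unique_directional_medians_def
    by (intro directional_median_continuous) blast
  have "row i U \<in> sphere 0 1" if "orthogonal_matrix U" for i and U :: "real ^ _ ^ _"
    using orthogonal_matrix_row_inner[OF that, of i i] by (simp add: norm_eq_1)
  then have "continuous_on {U. orthogonal_matrix U} (\<lambda>U. directional_median P (row i U))" for i
    by (intro continuous_on_compose2[OF dm row]) auto
  with row show ?thesis
    unfolding Psi_eq_sum_rows by (intro continuous_intros)
qed

text \<open>
  Since \<open>\<langle>A b, S x - S \<theta>\<rangle> = \<langle>b, x - \<theta>\<rangle>\<close> for \<open>S x = A x + c\<close>, half-spaces and quarter-spaces
  pull back under \<open>S\<close> to those of the original problem.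
\<close>

lemma solves_quarter_median_motion:
  assumes sol: "solves_quarter_median P \<theta> U" and A: "orthogonal_matrix A"
  shows "solves_quarter_median (pushforward P (\<lambda>x. A *v x + c)) (A *v \<theta> + c) (U ** transpose A)"
proof -
  let ?S = "\<lambda>x. A *v x + c"
  have meas: "?S \<in> borel_measurable P"
    by (intro continuous_imp_measurable continuous_intros)
  have half: "?S x \<in> halfspace s (?S \<theta>) (A *v b) \<longleftrightarrow> x \<in> halfspace s \<theta> b" for s b x
    by (cases s) (simp_all add: matrix_vector_mult_diff_distrib[symmetric] orthogonal_matrix_inner[OF A])
  have "?S -` halfspace s (?S \<theta>) (A *v b) = halfspace s \<theta> b" for s b
    using half by auto
  moreover from half have
    "?S -` quarterspace s s' (?S \<theta>) (A *v b) (A *v b') = quarterspace s s' \<theta> b b'" for s s' b b'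
    unfolding quarterspace_def by auto
  ultimately show ?thesis
    using sol A meas unfolding solves_quarter_median_def
    by (simp add: row_mult_transpose measure_distr halfspace_borel quarterspace_borel
        orthogonal_matrix_mul orthogonal_matrix_transpose)
qed

lemma quarter_median_motion:
  assumes "is_quarter_median P \<theta>" "S \<in> euclidean_motions"
  shows "is_quarter_median (pushforward P S) (S \<theta>)"
  using assms solves_quarter_median_motion
  unfolding is_quarter_median_def euclidean_motions_def by blast

text \<open>
  Each coordinate of \<open>U \<theta>\<close> is a median of the corresponding marginal and is replaced by an
  almost surely equivalent one. The half-spaces at the new point then agree with the old ones
  up to null sets, and this passes to intersections.
\<close>

lemma solves_quarter_median_canonical:
  assumes sol: "solves_quarter_median P \<theta> U"
  obtains \<eta> where "\<eta> \<in> MMed_set (pushforward P (\<lambda>x. U *v x))"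
    "is_marginal_median (pushforward P (\<lambda>x. U *v x)) \<eta>"
    "solves_quarter_median P (transpose U *v \<eta>) U"
proof -
  let ?Q = "\<lambda>i. pushforward P (\<lambda>x. row i U \<bullet> x)"
  have U: "orthogonal_matrix U" using sol by (simp add: solves_quarter_median_def)
  let ?equiv = "\<lambda>i h. h \<in> {Med_minus (?Q i), Med_mid (?Q i), Med_plus (?Q i)} \<and>
      (AE y in ?Q i. (y \<le> row i U \<bullet> \<theta> \<longleftrightarrow> y \<le> h) \<and> (row i U \<bullet> \<theta> \<le> y \<longleftrightarrow> h \<le> y))"
  have "\<forall>i. \<exists>h. ?equiv i h"
  proof
    fix i
    interpret D: real_distribution "?Q i" by (rule real_distribution_directional)
    have "measure P (halfspace s \<theta> (row i U)) \<ge> 1/2" for s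
      using sol by (simp add: solves_quarter_median_def)
    from this[of Minus] this[of Plus] have "is_median (?Q i) (row i U \<bullet> \<theta>)"
      by (simp add: is_median_def measure_directional inner_diff_right)
    then obtain h where "h \<in> {Med_minus (?Q i), Med_mid (?Q i), Med_plus (?Q i)}"
      "AE y in ?Q i. (y \<le> row i U \<bullet> \<theta> \<longleftrightarrow> y \<le> h) \<and> (row i U \<bullet> \<theta> \<le> y \<longleftrightarrow> h \<le> y)"
      by (rule D.ex_canonical_equivalent_median)
    then show "\<exists>h. ?equiv i h" by (intro exI conjI)
  qed
  from choice[OF this] obtain h where "\<forall>i. ?equiv i (h i)" by (elim exE)
  then have h: "\<And>i. h i \<in> {Med_minus (?Q i), Med_mid (?Q i), Med_plus (?Q i)}"
    and ae: "\<And>i. AE y in ?Q i. (y \<le> row i U \<bullet> \<theta> \<longleftrightarrow> y \<le> h i) \<and> (row i U \<bullet> \<theta> \<le> y \<longleftrightarrow> h i \<le> y)"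
    by (simp_all only: all_conj_distrib)
  define \<eta> where "\<eta> = (\<chi> i. h i)"
  define \<theta>' where "\<theta>' = transpose U *v \<eta>"
  have \<theta>': "row i U \<bullet> \<theta>' = h i" for i
    unfolding \<theta>'_def row_inner_transpose_mult[OF U] by (simp add: \<eta>_def)
  have half: "AE x in P. x \<in> halfspace s \<theta> (row i U) \<longleftrightarrow> x \<in> halfspace s \<theta>' (row i U)" for s i
  proof -
    have "(\<lambda>x. row i U \<bullet> x) \<in> borel_measurable P"
      by (intro continuous_imp_measurable continuous_intros)
    from AE_distrD[OF this ae[of i]] show ?thesis
      by eventually_elim (auto simp: halfspace_iff \<theta>' split: side.split)
  qed
  have "measure P (halfspace s \<theta>' (row i U)) = measure P (halfspace s \<theta> (row i U))" for s i
    using half[of s i] by (intro measure_eq_AE) (auto simp: halfspace_borel)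
  moreover have "measure P (quarterspace s s' \<theta>' (row i U) (row j U))
      = measure P (quarterspace s s' \<theta> (row i U) (row j U))" for s s' i j
    using half[of s i] half[of s' j]
    by (intro measure_eq_AE) (auto simp: quarterspace_borel quarterspace_def intro: sets.Int halfspace_borel)
  ultimately have solves: "solves_quarter_median P \<theta>' U"
    using sol by (simp add: solves_quarter_median_def)
  have canonical: "\<eta> \<in> MMed_set (pushforward P (\<lambda>x. U *v x))"
    using h by (simp add: MMed_set_def marginal_pushforward \<eta>_def)
  have "is_marginal_median (pushforward P (\<lambda>x. U *v x)) \<eta>"
    unfolding is_marginal_median_def marginal_pushforward
  proof
    fix i
    interpret D: real_distribution "?Q i" by (rule real_distribution_directional)
    show "is_median (?Q i) (\<eta> $ i)"
      using h[of i] D.Med_mid_between D.Med_minus_le_Med_plus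
      by (auto simp: D.is_median_iff \<eta>_def)
  qed
  from that[OF canonical this] solves show ?thesis unfolding \<theta>'_def .
qed

end

theorem proposition1:
  fixes P :: "(real ^ 'n) measure"
  assumes "CARD('n) \<ge> 2"
    and "prob_space P"
    and "sets P = sets borel"
  shows
    "(\<forall>\<theta>. is_quarter_median P \<theta> \<longrightarrow>
        (\<forall>S \<in> euclidean_motions. is_quarter_median (pushforward P S) (S \<theta>)))
     \<and>
     (\<forall>U V. orthogonal_matrix U \<longrightarrow> orthogonal_matrix V \<longrightarrow> same_hyperplanes U V \<longrightarrow>
        Psi U P = Psi V P)
     \<and>
     (\<forall>\<theta> U. solves_quarter_median P \<theta> U \<longrightarrow>
        (\<exists>\<eta> \<in> MMed_set (pushforward P (\<lambda>x. U *v x)).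
           is_marginal_median (pushforward P (\<lambda>x. U *v x)) \<eta> \<and>
           solves_quarter_median P (transpose U *v \<eta>) U))
     \<and>
     (\<forall>\<theta> U A c. solves_quarter_median P \<theta> U \<longrightarrow> orthogonal_matrix A \<longrightarrow>
        solves_quarter_median (pushforward P (\<lambda>x. A *v x + c)) (A *v \<theta> + c) (U ** transpose A))
     \<and>
     (unique_directional_medians P \<longrightarrow>
        (\<forall>U A c. orthogonal_matrix U \<longrightarrow> orthogonal_matrix A \<longrightarrow>
           Psi (U ** transpose A) (pushforward P (\<lambda>x. A *v x + c)) = A *v Psi U P + c))
     \<and>
     (unique_directional_medians P \<longrightarrow>
        continuous_on {U. orthogonal_matrix U} (\<lambda>U. Psi U P))"
proof -
  interpret prob_space P by (rule assms(2))
  interpret vector_distribution P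
    by unfold_locales (rule assms(3))
  show ?thesis
  proof (intro conjI allI impI ballI)
    fix \<theta> :: "real ^ 'n" and S :: "real ^ 'n \<Rightarrow> real ^ 'n"
    assume "is_quarter_median P \<theta>" "S \<in> euclidean_motions"
    then show "is_quarter_median (pushforward P S) (S \<theta>)"
      by (rule quarter_median_motion)
  next
    fix U V :: "real ^ 'n ^ 'n"
    assume "orthogonal_matrix U" "orthogonal_matrix V" "same_hyperplanes U V"
    then show "Psi U P = Psi V P" by (rule Psi_cong_hyperplanes)
  next
    fix \<theta> :: "real ^ 'n" and U
    assume "solves_quarter_median P \<theta> U"
    then show "\<exists>\<eta> \<in> MMed_set (pushforward P (\<lambda>x. U *v x)).
        is_marginal_median (pushforward P (\<lambda>x. U *v x)) \<eta> \<and>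
        solves_quarter_median P (transpose U *v \<eta>) U"
      by (rule solves_quarter_median_canonical) (intro bexI conjI)
  next
    fix \<theta> c :: "real ^ 'n" and U A :: "real ^ 'n ^ 'n"
    assume "solves_quarter_median P \<theta> U" "orthogonal_matrix A"
    then show "solves_quarter_median (pushforward P (\<lambda>x. A *v x + c)) (A *v \<theta> + c)
        (U ** transpose A)"
      by (rule solves_quarter_median_motion)
  next
    fix U A :: "real ^ 'n ^ 'n" and c
    assume "orthogonal_matrix U" "orthogonal_matrix A"
    then show "Psi (U ** transpose A) (pushforward P (\<lambda>x. A *v x + c)) = A *v Psi U P + c"
      by (rule Psi_motion)
  next
    assume "unique_directional_medians P"
    then show "continuous_on {U. orthogonal_matrix U} (\<lambda>U. Psi U P)"
      by (rule Psi_continuous)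
  qed
qed

end
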